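(* Let $A$ be a finite-dimensional (left) Leibniz algebra over a field $F$ and suppose that every maximal subalgebra of $A$ is a right ideal of $A$. Then $A$ is nilpotent.
   Context: $F$ is an arbitrary field (any characteristic). A (left) Leibniz algebra is a vector space $A$ over $F$ with a bilinear product satisfying $a(bc)=(ab)c+b(ac)$ for all $a,b,c\in A$. A subalgebra $U$ is a right ideal of $A$ if $ua\in U$ for all $u\in U$, $a\in A$. A maximal subalgebra is a proper subalgebra maximal under inclusion among proper subalgebras. Powers of $A$ are defined by $A^1=A$, $A^{n+1}=AA^n$ (the linear span of all products $xy$ with $x\in A$, $y\in A^n$); $A$ is nilpotent if $A^k=0$ for some $k$. *)

theory Defs
  imports Complex_Main
begin

locale left_leibniz_algebra = vector_space scale
  for scale :: "'k::field \<Rightarrow> 'a::ab_group_add \<Rightarrow> 'a" +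
  fixes prod :: "'a \<Rightarrow> 'a \<Rightarrow> 'a"
  assumes linear_left: "Vector_Spaces.linear scale scale (\<lambda>x. prod x y)"
    and linear_right: "Vector_Spaces.linear scale scale (\<lambda>y. prod x y)"
    and leibniz: "prod a (prod b c) = prod (prod a b) c + prod b (prod a c)"
begin

definition subalgebra :: "'a set \<Rightarrow> bool" where
  "subalgebra U \<longleftrightarrow> subspace U \<and> (\<forall>x\<in>U. \<forall>y\<in>U. prod x y \<in> U)"

definition right_ideal :: "'a set \<Rightarrow> bool" where
  "right_ideal U \<longleftrightarrow> subalgebra U \<and> (\<forall>u\<in>U. \<forall>a. prod u a \<in> U)"

definition maximal_subalgebra :: "'a set \<Rightarrow> bool" where
  "maximal_subalgebra U \<longleftrightarrow> subalgebra U \<and> U \<noteq> UNIV \<and>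
     (\<forall>V. subalgebra V \<and> V \<noteq> UNIV \<and> U \<subseteq> V \<longrightarrow> V = U)"

definition set_prod :: "'a set \<Rightarrow> 'a set \<Rightarrow> 'a set" where
  "set_prod S T = span {prod x y | x y. x \<in> S \<and> y \<in> T}"

text \<open>The powers \<open>A\<^sup>1 = A\<close>, \<open>A\<^sup>n\<^sup>+\<^sup>1 = A A\<^sup>n\<close> start at \<open>n = 1\<close>;
  the value at \<open>n = 0\<close> is junk.\<close>

definition alg_power :: "nat \<Rightarrow> 'a set" where
  "alg_power n = (set_prod UNIV ^^ (n - 1)) UNIV"

lemma alg_power_1: "alg_power 1 = UNIV"
  by (simp add: alg_power_def)

lemma alg_power_Suc: "n \<ge> 1 \<Longrightarrow> alg_power (n + 1) = set_prod UNIV (alg_power n)"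
  by (cases n) (simp_all add: alg_power_def)

definition nilpotent :: bool where
  "nilpotent \<longleftrightarrow> (\<exists>k\<ge>1. alg_power k = {0})"

end

end

theory Submission
  imports Defs
begin

text \<open>Write \<open>L\<^sub>a\<close> for left multiplication by \<open>a\<close>. Its Fitting null component \<open>K\<close> is a subalgebra. The
  element \<open>a\<close> itself need not lie in \<open>K\<close>, but \<open>a\<^sup>2\<close> acts trivially from the left, so some \<open>b \<in> K\<close>
  satisfies \<open>L\<^sub>b = L\<^sub>a\<close>. If \<open>K\<close> were proper, it would lie in a maximal subalgebra \<open>M\<close>; being a right
  ideal, \<open>M\<close> contains \<open>b A = a A\<close> and hence the Fitting one component too, so \<open>M = A\<close>. Thus every
  \<open>L\<^sub>a\<close> is nilpotent, and Engel's theorem gives the nilpotency of \<open>A\<close>.\<close>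

locale fd_leibniz_algebra =
  left_leibniz_algebra scale prod + finite_dimensional_vector_space scale Basis
  for scale :: "'k::field \<Rightarrow> 'a::ab_group_add \<Rightarrow> 'a"
    and prod :: "'a \<Rightarrow> 'a \<Rightarrow> 'a"
    and Basis :: "'a set"
begin

section \<open>Linearity of the product and of iterated left multiplication\<close>

lemma prod_add_left: "prod (x + y) z = prod x z + prod y z"
  and prod_diff_left: "prod (x - y) z = prod x z - prod y z"
  and prod_scale_left: "prod (scale c x) z = scale c (prod x z)"
  and prod_zero_left: "prod 0 z = 0"
  by (fact linear_left[THEN Vector_Spaces.linear.axioms(3), THEN module_hom.add]
      linear_left[THEN Vector_Spaces.linear.axioms(3), THEN module_hom.diff]
      linear_left[THEN Vector_Spaces.linear.axioms(3), THEN module_hom.scale]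
      linear_left[THEN Vector_Spaces.linear.axioms(3), THEN module_hom.zero])+

lemma prod_add_right: "prod z (x + y) = prod z x + prod z y"
  and prod_diff_right: "prod z (x - y) = prod z x - prod z y"
  and prod_scale_right: "prod z (scale c x) = scale c (prod z x)"
  and prod_zero_right: "prod z 0 = 0"
  by (fact linear_right[THEN Vector_Spaces.linear.axioms(3), THEN module_hom.add]
      linear_right[THEN Vector_Spaces.linear.axioms(3), THEN module_hom.diff]
      linear_right[THEN Vector_Spaces.linear.axioms(3), THEN module_hom.scale]
      linear_right[THEN Vector_Spaces.linear.axioms(3), THEN module_hom.zero])+

lemmas prod_simps =
  prod_add_left prod_diff_left prod_scale_left prod_zero_left
  prod_add_right prod_diff_right prod_scale_right prod_zero_right

text \<open>The Leibniz identity read as a commutator rule for left multiplications, L_{ab} =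
  [L_a, L_b].\<close>

lemma prod_prod_left: "prod (prod a b) c = prod a (prod b c) - prod b (prod a c)"
  using leibniz[of a b c] by simp

lemma funpow_prod_simps:
  "(prod a ^^ n) (x + y) = (prod a ^^ n) x + (prod a ^^ n) y"
  "(prod a ^^ n) (x - y) = (prod a ^^ n) x - (prod a ^^ n) y"
  "(prod a ^^ n) (scale c x) = scale c ((prod a ^^ n) x)"
  "(prod a ^^ n) 0 = 0"
  by (induction n) (simp_all add: prod_simps)

lemma funpow_prod_eq_zero_mono:
  assumes "(prod a ^^ m) x = 0" "m \<le> n"
  shows "(prod a ^^ n) x = 0"
proof -
  have "(prod a ^^ n) x = (prod a ^^ (n - m)) ((prod a ^^ m) x)"
    using assms(2) by (simp flip: funpow_add[THEN fun_cong, unfolded o_apply])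
  then show ?thesis using assms(1) by (simp add: funpow_prod_simps)
qed

section \<open>Fitting's lemma for left multiplications\<close>

definition fitting_null :: "'a \<Rightarrow> 'a set" where
  "fitting_null a = {x. \<exists>m. (prod a ^^ m) x = 0}"

text \<open>\<open>prod a\<close> is a derivation, so its iterates distribute over the two factors
  of \<open>prod x y\<close>. Peeling off one application at a time, by induction on
  \<open>m + p\<close>, avoids the binomial formula.\<close>

lemma funpow_prod_prod_eq_zero:
  assumes "(prod a ^^ m) x = 0" "(prod a ^^ p) y = 0"
  shows "(prod a ^^ (m + p)) (prod x y) = 0"
  using assms
proof (induction "m + p" arbitrary: m p x y)
  case 0
  then show ?case by (simp add: prod_simps)
next
  case (Suc s)
  have "(prod a ^^ s) (prod (prod a x) y) = 0"
  proof (cases m)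
    case 0
    then show ?thesis using Suc.prems by (simp add: prod_simps funpow_prod_simps)
  next
    case (Suc m')
    then show ?thesis
      using Suc.hyps(1)[of m' p "prod a x" y] Suc.hyps(2) Suc.prems by (simp add: funpow_swap1)
  qed
  moreover have "(prod a ^^ s) (prod x (prod a y)) = 0"
  proof (cases p)
    case 0
    then show ?thesis using Suc.prems by (simp add: prod_simps funpow_prod_simps)
  next
    case (Suc p')
    then show ?thesis
      using Suc.hyps(1)[of m p' x "prod a y"] Suc.hyps(2) Suc.prems by (simp add: funpow_swap1)
  qed
  ultimately have "(prod a ^^ s) (prod a (prod x y)) = 0"
    by (simp add: leibniz[of a x y] funpow_prod_simps)
  then show ?case
    by (simp add: funpow_swap1 flip: Suc.hyps(2))
qed

lemma subalgebra_fitting_null: "subalgebra (fitting_null a)"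
  unfolding subalgebra_def
proof (intro conjI ballI subspaceI)
  show "0 \<in> fitting_null a"
    by (auto simp: fitting_null_def funpow_prod_simps)
next
  fix x y assume "x \<in> fitting_null a" "y \<in> fitting_null a"
  then obtain m p where mp: "(prod a ^^ m) x = 0" "(prod a ^^ p) y = 0"
    by (auto simp: fitting_null_def)
  from mp have "(prod a ^^ (m + p)) (x + y) = 0"
    by (simp add: funpow_prod_simps funpow_prod_eq_zero_mono[OF mp(1)]
        funpow_prod_eq_zero_mono[OF mp(2)])
  then show "x + y \<in> fitting_null a" unfolding fitting_null_def by blast
  show "prod x y \<in> fitting_null a"
    using funpow_prod_prod_eq_zero[OF mp] unfolding fitting_null_def by blast
next
  fix c x assume "x \<in> fitting_null a"
  then show "scale c x \<in> fitting_null a"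
    by (auto simp: fitting_null_def funpow_prod_simps)
qed

lemma subspace_image_funpow_prod:
  assumes "subspace C"
  shows "subspace ((prod a ^^ n) ` C)"
proof (rule subspaceI)
  show "0 \<in> (prod a ^^ n) ` C"
    using subspace_0[OF assms] funpow_prod_simps(4) by (metis imageI)
next
  fix x y assume "x \<in> (prod a ^^ n) ` C" "y \<in> (prod a ^^ n) ` C"
  then show "x + y \<in> (prod a ^^ n) ` C"
    using subspace_add[OF assms] funpow_prod_simps(1) by (smt (verit) image_iff)
next
  fix c x assume "x \<in> (prod a ^^ n) ` C"
  then show "scale c x \<in> (prod a ^^ n) ` C"
    using subspace_scale[OF assms] funpow_prod_simps(3) by (smt (verit) image_iff)
qed

text \<open>The images of \<open>C\<close> under the powers of \<open>prod a\<close> decrease and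
  become stationary, by dimension. An invariant \<open>C\<close> in place of the whole space lets
  \<open>w\<close> be chosen with extra properties.\<close>

lemma fitting_decomposition:
  assumes C: "subspace C" and inv: "\<And>x. x \<in> C \<Longrightarrow> prod a x \<in> C" and v: "v \<in> C"
  obtains w where "w \<in> C" "v - prod a w \<in> fitting_null a"
proof -
  define I where "I n = (prod a ^^ n) ` C" for n
  have sub: "subspace (I n)" for n
    unfolding I_def by (rule subspace_image_funpow_prod[OF C])
  have I_Suc: "I (Suc n) = prod a ` I n" for n
    by (simp add: I_def image_comp)
  have dec: "I (Suc n) \<subseteq> I n" for n
    unfolding I_def using inv by (auto simp: funpow_swap1)
  obtain n where n: "\<And>k. dim (I n) \<le> dim (I k)"
    using ex_has_least_nat[of "\<lambda>_. True" 0 "\<lambda>n. dim (I n)"] by auto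
  have step: "I (Suc n) = I n"
    using subspace_dim_equal[OF sub sub dec] n by blast
  have "I (n + k) = I n" for k
    by (induction k) (simp_all add: I_Suc step[unfolded I_Suc])
  \<comment> \<open>The exponent \<open>n + Suc n\<close> leaves one factor \<open>prod a\<close>
    between two blocks of \<open>n\<close>, so that \<open>prod a ^^ n\<close> kills
    \<open>v - prod a w\<close> for w = L_a^n u.\<close>
  from this[of "Suc n"] have "(prod a ^^ n) v \<in> I (n + Suc n)"
    using v by (simp add: I_def)
  then obtain u where u: "u \<in> C" "(prod a ^^ n) v = (prod a ^^ (n + Suc n)) u"
    by (auto simp: I_def)
  let ?w = "(prod a ^^ n) u"
  have "?w \<in> C"
    using u(1) by (induction n) (auto intro: inv)
  moreover have "(prod a ^^ n) (v - prod a ?w) = 0"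
    using u(2) by (simp add: funpow_prod_simps funpow_add funpow_swap1)
  ultimately show ?thesis
    using that[of ?w] by (auto simp: fitting_null_def)
qed

lemma fitting_null_same_left_mult:
  obtains b where "b \<in> fitting_null a" "prod b = prod a"
proof -
  \<comment> \<open>The elements whose left multiplication is a multiple of L_a. For x in
    \<open>C\<close>, L_{ax} = [L_a, L_x] = 0, so \<open>C\<close> is invariant under L_a, and
    subtracting \<open>prod a w\<close> from \<open>a\<close> does not change its left
    multiplication.\<close>
  define C where "C = {x. \<exists>c. \<forall>y. prod x y = scale c (prod a y)}"
  have "subspace C"
  proof (rule subspaceI)
    show "0 \<in> C"
      unfolding C_def by (auto intro!: exI[of _ 0] simp: prod_simps)
  next
    fix x y assume "x \<in> C" "y \<in> C"
    then obtain c d where "\<forall>z. prod x z = scale c (prod a z)" "\<forall>z. prod y z = scale d (prod a z)"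
      by (auto simp: C_def)
    then show "x + y \<in> C"
      unfolding C_def by (auto intro!: exI[of _ "c + d"] simp: prod_simps scale_left_distrib)
  next
    fix c x assume "x \<in> C"
    then obtain d where "\<forall>z. prod x z = scale d (prod a z)"
      by (auto simp: C_def)
    then show "scale c x \<in> C"
      unfolding C_def by (auto intro!: exI[of _ "c * d"] simp: prod_simps)
  qed
  moreover have null: "prod (prod a x) y = 0" if "x \<in> C" for x y
    using that by (auto simp: C_def prod_prod_left prod_simps)
  moreover have "prod a x \<in> C" if "x \<in> C" for x
    using null[OF that] by (auto intro!: exI[of _ 0] simp: C_def)
  moreover have "a \<in> C"
    by (auto intro!: exI[of _ 1] simp: C_def)
  ultimately obtain w where "w \<in> C" "a - prod a w \<in> fitting_null a"
    using fitting_decomposition by metis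
  moreover have "prod (a - prod a w) = prod a"
    using null[OF \<open>w \<in> C\<close>] by (simp add: prod_simps fun_eq_iff)
  ultimately show ?thesis using that by blast
qed

section \<open>Maximal subalgebras and nilpotency of left multiplications\<close>

text \<open>A candidate of largest dimension is maximal. The ambient \<open>S\<close> varies because
  Engel's theorem needs maximal subalgebras of subalgebras.\<close>

lemma subset_maximal_subalgebra:
  assumes S: "subalgebra S" and proper: "U \<subset> S" and U: "subalgebra U"
  obtains M where "subalgebra M" "U \<subseteq> M" "M \<subset> S"
    "\<And>V. subalgebra V \<Longrightarrow> M \<subseteq> V \<Longrightarrow> V \<subset> S \<Longrightarrow> V = M"
proof -
  let ?P = "\<lambda>M. subalgebra M \<and> U \<subseteq> M \<and> M \<subset> S"
  have "dim V < Suc dimension" for V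
    by (rule le_imp_less_Suc) (rule dim_subset_UNIV)
  then have "\<exists>M. ?P M \<and> (\<forall>V. ?P V \<longrightarrow> dim V \<le> dim M)"
    using U proper by (intro ex_has_greatest_nat[of ?P U dim "Suc dimension"]) (auto intro: less_imp_le)
  then obtain M where M: "?P M" "\<And>V. ?P V \<Longrightarrow> dim V \<le> dim M"
    by blast
  show ?thesis
  proof (rule that)
    fix V assume V: "subalgebra V" "M \<subseteq> V" "V \<subset> S"
    then have "dim V \<le> dim M" using M by blast
    then show "V = M"
      using subspace_dim_equal[of M V] V(1,2) M(1) by (simp add: subalgebra_def)
  qed (use M(1) in blast)+
qed

lemma subalgebra_UNIV: "subalgebra UNIV"
  by (simp add: subalgebra_def)

lemma left_mult_nilpotent:
  assumes max: "\<And>U. maximal_subalgebra U \<Longrightarrow> right_ideal U"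
  shows "fitting_null a = UNIV"
proof (rule ccontr)
  assume "fitting_null a \<noteq> UNIV"
  then obtain M where M: "subalgebra M" "fitting_null a \<subseteq> M" "M \<subset> UNIV"
    "\<And>V. subalgebra V \<Longrightarrow> M \<subseteq> V \<Longrightarrow> V \<subset> UNIV \<Longrightarrow> V = M"
    using subset_maximal_subalgebra[OF subalgebra_UNIV _ subalgebra_fitting_null] by blast
  then have ri: "right_ideal M"
    by (intro max) (auto simp: maximal_subalgebra_def)
  obtain b where b: "b \<in> fitting_null a" "prod b = prod a"
    by (rule fitting_null_same_left_mult)
  have "v \<in> M" for v
  proof -
    obtain w where "v - prod a w \<in> fitting_null a"
      using fitting_decomposition[of UNIV a v] by auto
    moreover have "prod a w \<in> M"
      using ri b M(2) unfolding right_ideal_def by (metis subsetD)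
    ultimately show ?thesis
      using M(1,2) subspace_add[of M "v - prod a w" "prod a w"] by (auto simp: subalgebra_def)
  qed
  then show False using M(3) by blast
qed

section \<open>Engel's theorem\<close>

lemma subspace_annihilated_into:
  assumes "subspace V" "subspace W"
  shows "subspace {x \<in> V. \<forall>t\<in>T. prod t x \<in> W}"
  by (rule subspaceI) (auto simp: prod_simps subspace_0 subspace_add subspace_scale assms)

text \<open>If x and y both send u into \<open>W\<close>, so does xy, because L_{xy} = [L_x, L_y]
  and \<open>S\<close> preserves \<open>W\<close>.\<close>

lemma subalgebra_annihilator:
  assumes "subalgebra S" "subspace W" and "\<And>s w. s \<in> S \<Longrightarrow> w \<in> W \<Longrightarrow> prod s w \<in> W"
  shows "subalgebra {s \<in> S. \<forall>u\<in>U. prod s u \<in> W}"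
proof -
  have "subspace S" and closed: "\<And>x y. x \<in> S \<Longrightarrow> y \<in> S \<Longrightarrow> prod x y \<in> S"
    using assms(1) by (auto simp: subalgebra_def)
  then have "subspace {s \<in> S. \<forall>u\<in>U. prod s u \<in> W}"
    by (intro subspaceI)
      (auto simp: prod_simps subspace_0 subspace_add subspace_scale assms(2))
  moreover have "prod (prod x y) u \<in> W"
    if "x \<in> S" "y \<in> S" "prod x u \<in> W" "prod y u \<in> W" for x y u
    using that assms(3) subspace_diff[OF assms(2)] by (simp add: prod_prod_left)
  ultimately show ?thesis
    using closed unfolding subalgebra_def by blast
qed

text \<open>Engel's theorem for the action of \<open>S\<close> on V/W, phrased without quotients:
  \<open>x\<close> represents a nonzero vector killed by \<open>S\<close>. With \<open>V\<close> and
  \<open>W\<close> arbitrary, the induction on \<open>dim S\<close> can be used for different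
  modules.\<close>

theorem engel:
  assumes nil: "\<And>a. fitting_null a = UNIV"
    and "subalgebra S" "subspace V" "subspace W" "W \<subset> V"
    and "\<And>s v. s \<in> S \<Longrightarrow> v \<in> V \<Longrightarrow> prod s v \<in> V"
    and "\<And>s w. s \<in> S \<Longrightarrow> w \<in> W \<Longrightarrow> prod s w \<in> W"
  shows "\<exists>x\<in>V - W. \<forall>s\<in>S. prod s x \<in> W"
  using assms(2-)
proof (induction "dim S" arbitrary: S V W rule: less_induct)
  case less
  show ?case
  proof (cases "S = {0}")
    case True
    then show ?thesis
      using less.prems by (auto simp: prod_simps subspace_0)
  next
    case False
    have "subalgebra {0}"
      by (simp add: subalgebra_def prod_simps)
    moreover have "{0} \<subset> S"
      using False less.prems(1) subspace_0[of S] by (auto simp: subalgebra_def)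
    ultimately obtain T where T: "subalgebra T" "T \<subset> S"
      "\<And>P. subalgebra P \<Longrightarrow> T \<subseteq> P \<Longrightarrow> P \<subset> S \<Longrightarrow> P = T"
      using subset_maximal_subalgebra[OF less.prems(1)] by metis
    have "dim T < dim S"
      using T(1,2) less.prems(1) subspace_dim_equal[of T S] dim_subset[of T S]
      by (fastforce simp: subalgebra_def)
    note IH = less.hyps[OF this T(1)]
    \<comment> \<open>First use of the induction hypothesis: \<open>T\<close> acts on S/T.\<close>
    have "\<exists>x\<in>S - T. \<forall>t\<in>T. prod t x \<in> T"
      using T(1,2) less.prems(1) by (intro IH) (auto simp: subalgebra_def)
    then obtain x where x: "x \<in> S" "x \<notin> T" "\<And>t. t \<in> T \<Longrightarrow> prod t x \<in> T"
      by blast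
    \<comment> \<open>Second use: \<open>T\<close> acts on V/W.\<close>
    have "\<exists>y\<in>V - W. \<forall>t\<in>T. prod t y \<in> W"
      using T(2) less.prems by (intro IH) auto
    then obtain y where y: "y \<in> V" "y \<notin> W" "\<And>t. t \<in> T \<Longrightarrow> prod t y \<in> W"
      by blast
    define U where "U = {v \<in> V. \<forall>t\<in>T. prod t v \<in> W}"
    \<comment> \<open>By the Leibniz identity t(xv) = (tx)v + x(tv); here tx lies in
      \<open>T\<close>, and tv lies in \<open>W\<close>, which x preserves.\<close>
    have U: "prod x v \<in> U" if "v \<in> U" for v
      using that x less.prems(2-) T(2) unfolding U_def
      by (auto simp: leibniz[of _ x v] intro!: subspace_add)
    obtain m where "(prod x ^^ m) y = 0"
      using nil[of x] by (auto simp: fitting_null_def)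
    then have ex: "\<exists>m. (prod x ^^ m) y \<in> W"
      using subspace_0[OF less.prems(3)] by metis
    \<comment> \<open>The last iterate before L_x first moves \<open>y\<close> into \<open>W\<close>
      is killed modulo \<open>W\<close> by x as well as by \<open>T\<close>. Such an iterate exists
      because \<open>y\<close> is outside \<open>W\<close>, so \<open>k\<close> is positive.\<close>
    define k where "k = (LEAST m. (prod x ^^ m) y \<in> W)"
    have k: "(prod x ^^ k) y \<in> W"
      unfolding k_def by (rule LeastI_ex[OF ex])
    then obtain j where j: "k = Suc j"
      using y(2) by (cases k) auto
    define u where "u = (prod x ^^ j) y"
    have "u \<notin> W"
      unfolding u_def by (rule not_less_Least) (simp add: j flip: k_def)
    moreover have "prod x u \<in> W"
      using k by (simp add: j u_def)
    moreover have "y \<in> U"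
      using y by (simp add: U_def)
    then have "u \<in> U"
      unfolding u_def by (induction j) (simp_all add: U)
    ultimately have u: "u \<in> V - W" "prod x u \<in> W" "\<And>t. t \<in> T \<Longrightarrow> prod t u \<in> W"
      by (auto simp: U_def)
    \<comment> \<open>All of \<open>S\<close> kills \<open>?U\<close> modulo \<open>W\<close>: the
      elements doing so form a subalgebra that contains \<open>T\<close> and x, hence equals
      \<open>S\<close> by maximality of \<open>T\<close>. No spanning of \<open>S\<close> by
      \<open>T\<close> and x is required.\<close>
    let ?U = "{v \<in> V. \<forall>s\<in>insert x T. prod s v \<in> W}"
    let ?P = "{s \<in> S. \<forall>v\<in>?U. prod s v \<in> W}"
    have "subalgebra ?P"
      using less.prems by (intro subalgebra_annihilator) auto
    moreover have "T \<subseteq> ?P" "x \<in> ?P"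
      using T(2) x(1) by auto
    ultimately have "?P = S"
      using T(3)[of ?P] x(2) by blast
    moreover have "u \<in> ?U" using u by auto
    ultimately show ?thesis using u(1) by blast
  qed
qed

section \<open>The ascending annihilator series and nilpotency\<close>

text \<open>Stage \<open>n\<close> consists of the x with a_1(a_2(...(a_n x))) = 0 for all a_1, ...,
  a_n.\<close>

fun upper_series :: "nat \<Rightarrow> 'a set" where
  "upper_series 0 = {0}"
| "upper_series (Suc n) = {x. \<forall>a. prod a x \<in> upper_series n}"

lemma subspace_upper_series: "subspace (upper_series n)"
proof (induction n)
  case (Suc n)
  then show ?case
    using subspace_annihilated_into[OF subspace_UNIV Suc, of UNIV] by simp
qed simp

lemma upper_series_mono: "upper_series n \<subseteq> upper_series (Suc n)"
  by (induction n) (auto simp: prod_simps)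

text \<open>A stage of largest dimension is stationary. Were it proper, Engel's theorem for the
  algebra acting on the quotient by it would yield a new element of the next stage.\<close>

lemma upper_series_eq_UNIV:
  assumes nil: "\<And>a. fitting_null a = UNIV"
  shows "\<exists>n. upper_series n = UNIV"
proof -
  have "\<exists>n. \<forall>k. dim (upper_series k) \<le> dim (upper_series n)"
    using ex_has_greatest_nat[of "\<lambda>_. True" 0 "\<lambda>n. dim (upper_series n)" "Suc dimension"]
    by (simp add: le_imp_less_Suc dim_subset_UNIV)
  then obtain n where n: "\<And>k. dim (upper_series k) \<le> dim (upper_series n)"
    by blast
  have eq: "upper_series (Suc n) = upper_series n"
    using subspace_dim_equal[OF subspace_upper_series subspace_upper_series upper_series_mono] n
    by blast
  have "upper_series n = UNIV"
  proof (rule ccontr)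
    assume "upper_series n \<noteq> UNIV"
    then have "\<exists>x\<in>UNIV - upper_series n. \<forall>s\<in>UNIV. prod s x \<in> upper_series n"
      using upper_series_mono[of n] subspace_upper_series[of n]
      by (intro engel nil) (auto simp: subalgebra_UNIV)
    then show False using eq by auto
  qed
  then show ?thesis by blast
qed

text \<open>Each left multiplication by the algebra descends one stage of the series. Only
  \<open>m = 0\<close> is wanted in the end, but the induction needs every \<open>m\<close>.\<close>

lemma funpow_set_prod_subset:
  assumes "upper_series (m + k) = UNIV"
  shows "(set_prod UNIV ^^ k) UNIV \<subseteq> upper_series m"
  using assms
proof (induction k arbitrary: m)
  case (Suc k)
  then have "(set_prod UNIV ^^ k) UNIV \<subseteq> upper_series (Suc m)"
    by (intro Suc.IH) simp
  then have "{prod x y | x y. x \<in> UNIV \<and> y \<in> (set_prod UNIV ^^ k) UNIV} \<subseteq> upper_series m"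
    by auto
  from span_minimal[OF this subspace_upper_series] show ?case
    by (simp add: set_prod_def[of UNIV "(set_prod UNIV ^^ k) UNIV"])
qed simp

lemma subspace_funpow_set_prod: "subspace ((set_prod UNIV ^^ k) UNIV)"
  by (cases k) (simp_all add: set_prod_def)

lemma nilpotent_if_maximal_right_ideal:
  assumes "\<And>U. maximal_subalgebra U \<Longrightarrow> right_ideal U"
  shows nilpotent
proof -
  obtain n where "upper_series n = UNIV"
    using upper_series_eq_UNIV left_mult_nilpotent[OF assms] by blast
  \<comment> \<open>Powers are numbered from 1, so \<open>n\<close> descents bound the power with
    index \<open>Suc n\<close>.\<close>
  then have "alg_power (Suc n) \<subseteq> {0}"
    using funpow_set_prod_subset[of 0 n] by (simp add: alg_power_def)
  then have "alg_power (Suc n) = {0}"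
    using subspace_0[OF subspace_funpow_set_prod[of n]] by (auto simp: alg_power_def)
  then show ?thesis
    unfolding nilpotent_def by (intro exI[of _ "Suc n"]) simp
qed

end

theorem theorem3p3:
  fixes scale :: "'k::field \<Rightarrow> 'a::ab_group_add \<Rightarrow> 'a"
    and prod :: "'a \<Rightarrow> 'a \<Rightarrow> 'a"
  assumes "left_leibniz_algebra scale prod"
    and "\<exists>B. finite_dimensional_vector_space scale B"
    and "\<And>U. left_leibniz_algebra.maximal_subalgebra scale prod U \<Longrightarrow>
           left_leibniz_algebra.right_ideal scale prod U"
  shows "left_leibniz_algebra.nilpotent scale prod"
proof -
  from assms(2) obtain B where "finite_dimensional_vector_space scale B" ..
  with assms(1) interpret fd_leibniz_algebra scale prod B
    by (rule fd_leibniz_algebra.intro)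
  show ?thesis
    using assms(3) by (rule nilpotent_if_maximal_right_ideal)
qed

end
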